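(* Work in the "linear" axiomatic framework for three-dimensional projective space described in the context. If statement [H$_{\mathrm{pl}}$] holds, then statement [H$_{\mathrm{pt}}$] holds, where: [H$_{\mathrm{pl}}$]: for every plane-tetrad $o,p,q,r$, its diagonals $a,b,c$ (the unique lines with $a\in\mathrm{pt}(o,p)\cap\mathrm{pt}(q,r)$, $b\in\mathrm{pt}(o,q)\cap\mathrm{pt}(r,p)$, $c\in\mathrm{pt}(o,r)\cap\mathrm{pt}(p,q)$) form a plane-triad; [H$_{\mathrm{pt}}$]: for every point-tetrad $o,p,q,r$, its diagonals $a,b,c$ (the unique lines with $a\in\mathrm{pl}(o,p)\cap\mathrm{pl}(q,r)$, $b\in\mathrm{pl}(o,q)\cap\mathrm{pl}(r,p)$, $c\in\mathrm{pl}(o,r)\cap\mathrm{pl}(p,q)$) form a point-triad.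
   Context: Let $\mathbb{L}$ be a set (whose elements are called lines) with a symmetric reflexive relation $\sim$ (incidence). Lines that are not incident are called skew. For $S \subseteq \mathbb{L}$ let $S^{\sim}$ be the set of all lines incident to every line of $S$, and write $[l_1 \dots l_n] = \{l_1,\dots,l_n\}^{\sim}$. The axioms are: Axiom [1]: for each line $l$, the set $\{l\}^{\sim}$ contains three pairwise skew lines. Axiom [2]: for each incident pair of distinct lines $a,b$: (2.1) $[ab]$ contains skew pairs of lines; (2.2) if $c \in [ab]\setminus[ab]^{\sim}$ is one of such a skew pair, then no skew pairs lie in $[abc]$; (2.3) if $x,y$ is a skew pair in $[ab]$ then $[ab] = [abx]\cup[aby]$. Axiom [3]: if $a,b$ is an incident line pair and $c \in [ab]\setminus[ab]^{\sim}$, then there exist an incident line pair $p,q$ and $r \in [pq]\setminus[pq]^{\sim}$ with $[abc]\cap[pqr]=\emptyset$. For incident distinct lines $a,b$ put $\Sigma(a,b) = [ab]\setminus[ab]^{\sim}$; incidence restricted to $\Sigma(a,b)$ is an equivalence relation with exactly two classes, which (as part of the structure) are labelled $\Sigma_{\mathrm{pt}}(a,b)$ and $\Sigma_{\mathrm{pl}}(a,b)$. The point $\mathrm{pt}(a,b) = [abc]$ with $c \in \Sigma_{\mathrm{pt}}(a,b)$ and the plane $\mathrm{pl}(a,b) = [abc]$ with $c \in \Sigma_{\mathrm{pl}}(a,b)$ are independent of the choice of $c$. Axiom [4]: whenever $a,b$ and $p,q$ are pairs of distinct incident lines, $\mathrm{pt}(a,b)\cap\mathrm{pt}(p,q)\neq\emptyset$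 and $\mathrm{pl}(a,b)\cap\mathrm{pl}(p,q)\neq\emptyset$. A triad is a triple of pairwise-incident lines $a,b,c$ with $c \in \Sigma(a,b)$ (equivalently $a\in\Sigma(b,c)$, equivalently $b \in \Sigma(c,a)$). It is a plane-triad if $a\in\Sigma_{\mathrm{pl}}(b,c)$, $b\in\Sigma_{\mathrm{pl}}(c,a)$, $c\in\Sigma_{\mathrm{pl}}(a,b)$, and a point-triad if the same holds with $\mathrm{pt}$ in place of $\mathrm{pl}$. A plane-tetrad (resp. point-tetrad) is a set $\{o,p,q,r\}$ of four pairwise-incident lines such that each of the triples $\{p,q,r\},\{o,q,r\},\{o,r,p\},\{o,p,q\}$ is a plane-triad (resp. point-triad). For a tetrad, each of the six intersections used to define its diagonals consists of exactly one line. *)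

theory Defs
  imports Main
begin

locale line_incidence =
  fixes inc :: "'l \<Rightarrow> 'l \<Rightarrow> bool"  (infix "\<sim>" 50)
begin

text \<open>The bracket \<open>[l\<^sub>1 \<dots> l\<^sub>n]\<close> of the mathematical notation is \<open>{l\<^sub>1, \<dots>, l\<^sub>n}\<^sup>\<sim>\<close>.\<close>

definition incident_to_all :: "'l set \<Rightarrow> 'l set"  ("_\<^sup>\<sim>" [1000] 999)
  where "S\<^sup>\<sim> = {l. \<forall>s\<in>S. l \<sim> s}"

definition Sigma_lines :: "'l \<Rightarrow> 'l \<Rightarrow> 'l set"
  where "Sigma_lines a b = {a, b}\<^sup>\<sim> - ({a, b}\<^sup>\<sim>)\<^sup>\<sim>"

definition inc_on :: "'l set \<Rightarrow> 'l rel"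
  where "inc_on S = {(x, y). x \<in> S \<and> y \<in> S \<and> x \<sim> y}"

definition triad :: "'l \<Rightarrow> 'l \<Rightarrow> 'l \<Rightarrow> bool"
  where "triad a b c \<longleftrightarrow>
    distinct [a, b, c] \<and> a \<sim> b \<and> b \<sim> c \<and> c \<sim> a \<and> c \<in> Sigma_lines a b"

end

text \<open>The labels \<open>Sigma_pt a b\<close> and \<open>Sigma_pl a b\<close> are meaningful only for distinct
  incident \<open>a\<close>, \<open>b\<close>; their values at other arguments are arbitrary and never used.\<close>

locale labelled_line_incidence = line_incidence inc
  for inc :: "'l \<Rightarrow> 'l \<Rightarrow> bool"  (infix "\<sim>" 50) +
  fixes Sigma_pt Sigma_pl :: "'l \<Rightarrow> 'l \<Rightarrow> 'l set"
begin

text \<open>The axioms below make \<open>pt\<close> and \<open>pl\<close> independent of the chosen \<open>c\<close>.\<close>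

definition pt :: "'l \<Rightarrow> 'l \<Rightarrow> 'l set"
  where "pt a b = {a, b, SOME c. c \<in> Sigma_pt a b}\<^sup>\<sim>"

definition pl :: "'l \<Rightarrow> 'l \<Rightarrow> 'l set"
  where "pl a b = {a, b, SOME c. c \<in> Sigma_pl a b}\<^sup>\<sim>"

definition plane_triad :: "'l \<Rightarrow> 'l \<Rightarrow> 'l \<Rightarrow> bool"
  where "plane_triad a b c \<longleftrightarrow>
    triad a b c \<and> a \<in> Sigma_pl b c \<and> b \<in> Sigma_pl c a \<and> c \<in> Sigma_pl a b"

definition point_triad :: "'l \<Rightarrow> 'l \<Rightarrow> 'l \<Rightarrow> bool"
  where "point_triad a b c \<longleftrightarrow>
    triad a b c \<and> a \<in> Sigma_pt b c \<and> b \<in> Sigma_pt c a \<and> c \<in> Sigma_pt a b"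

text \<open>Pairwise incidence and distinctness of the four lines are contained in the triad
  conditions. Since \<open>o\<close> is reserved syntax, the first line is called \<open>s\<close>.\<close>

definition plane_tetrad :: "'l \<Rightarrow> 'l \<Rightarrow> 'l \<Rightarrow> 'l \<Rightarrow> bool"
  where "plane_tetrad s p q r \<longleftrightarrow>
    plane_triad p q r \<and> plane_triad s q r \<and> plane_triad s r p \<and> plane_triad s p q"

definition point_tetrad :: "'l \<Rightarrow> 'l \<Rightarrow> 'l \<Rightarrow> 'l \<Rightarrow> bool"
  where "point_tetrad s p q r \<longleftrightarrow>
    point_triad p q r \<and> point_triad s q r \<and> point_triad s r p \<and> point_triad s p q"

text \<open>The axioms below make the intersections under \<open>the_elem\<close> singletons.\<close>

definition H_pl :: bool
  where "H_pl \<longleftrightarrow> (\<forall>s p q r. plane_tetrad s p q r \<longrightarrow>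
    plane_triad (the_elem (pt s p \<inter> pt q r))
                (the_elem (pt s q \<inter> pt r p))
                (the_elem (pt s r \<inter> pt p q)))"

definition H_pt :: bool
  where "H_pt \<longleftrightarrow> (\<forall>s p q r. point_tetrad s p q r \<longrightarrow>
    point_triad (the_elem (pl s p \<inter> pl q r))
                (the_elem (pl s q \<inter> pl r p))
                (the_elem (pl s r \<inter> pl p q)))"

end

locale linear_projective_space = labelled_line_incidence inc Sigma_pt Sigma_pl
  for inc :: "'l \<Rightarrow> 'l \<Rightarrow> bool"  (infix "\<sim>" 50)
    and Sigma_pt Sigma_pl :: "'l \<Rightarrow> 'l \<Rightarrow> 'l set" +
  assumes inc_refl: "l \<sim> l"
    and inc_sym: "k \<sim> l \<Longrightarrow> l \<sim> k"
    and axiom1: "\<exists>x\<in>{l}\<^sup>\<sim>. \<exists>y\<in>{l}\<^sup>\<sim>. \<exists>z\<in>{l}\<^sup>\<sim>. \<not> x \<sim> y \<and> \<not> y \<sim> z \<and> \<not> z \<sim> x"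
    and axiom2_1: "a \<noteq> b \<Longrightarrow> a \<sim> b \<Longrightarrow> \<exists>x\<in>{a, b}\<^sup>\<sim>. \<exists>y\<in>{a, b}\<^sup>\<sim>. \<not> x \<sim> y"
    and axiom2_2: "a \<noteq> b \<Longrightarrow> a \<sim> b \<Longrightarrow> c \<in> Sigma_lines a b \<Longrightarrow>
      \<not> (\<exists>x\<in>{a, b, c}\<^sup>\<sim>. \<exists>y\<in>{a, b, c}\<^sup>\<sim>. \<not> x \<sim> y)"
    and axiom2_3: "a \<noteq> b \<Longrightarrow> a \<sim> b \<Longrightarrow> x \<in> {a, b}\<^sup>\<sim> \<Longrightarrow> y \<in> {a, b}\<^sup>\<sim> \<Longrightarrow> \<not> x \<sim> y \<Longrightarrow>
      {a, b}\<^sup>\<sim> = {a, b, x}\<^sup>\<sim> \<union> {a, b, y}\<^sup>\<sim>"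
    and axiom3: "a \<noteq> b \<Longrightarrow> a \<sim> b \<Longrightarrow> c \<in> Sigma_lines a b \<Longrightarrow>
      \<exists>p q r. p \<noteq> q \<and> p \<sim> q \<and> r \<in> Sigma_lines p q \<and> {a, b, c}\<^sup>\<sim> \<inter> {p, q, r}\<^sup>\<sim> = {}"
    and labelling: "a \<noteq> b \<Longrightarrow> a \<sim> b \<Longrightarrow>
      Sigma_pt a b \<noteq> Sigma_pl a b \<and>
      Sigma_lines a b // inc_on (Sigma_lines a b) = {Sigma_pt a b, Sigma_pl a b}"
    and axiom4_pt: "a \<noteq> b \<Longrightarrow> a \<sim> b \<Longrightarrow> p \<noteq> q \<Longrightarrow> p \<sim> q \<Longrightarrow> pt a b \<inter> pt p q \<noteq> {}"
    and axiom4_pl: "a \<noteq> b \<Longrightarrow> a \<sim> b \<Longrightarrow> p \<noteq> q \<Longrightarrow> p \<sim> q \<Longrightarrow> pl a b \<inter> pl p q \<noteq> {}"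

end

theory Submission
  imports Defs
begin

text \<open>Call a set \<open>[abc]\<close> with \<open>c \<in> \<Sigma>(a,b)\<close> a spot. Spots are maximal cliques, and two distinct
  incident lines lie on exactly two of them, a point and a plane.

  Let \<open>s, p, q, r\<close> be a point-tetrad at the point \<open>P\<close>, with diagonals \<open>a, b, c\<close>, and choose a
  plane \<open>\<pi>\<close> disjoint from \<open>P\<close>. The planes \<open>sp, qr, sq, rp\<close> meet \<open>\<pi>\<close> in a plane-tetrad whose
  diagonals are the intersections of \<open>\<pi>\<close> with the planes \<open>ab, sr, pq\<close>. If \<open>a, b, c\<close> lay in one
  plane, then these three diagonals would share the point in which \<open>c\<close> meets \<open>\<pi>\<close>.\<close>

context linear_projective_space
begin

section \<open>Spots as maximal cliques\<close>

definition spot :: "'l set \<Rightarrow> bool"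
  where "spot X \<longleftrightarrow> (\<exists>a b c. a \<noteq> b \<and> a \<sim> b \<and> c \<in> Sigma_lines a b \<and> X = {a, b, c}\<^sup>\<sim>)"

definition is_point :: "'l set \<Rightarrow> bool"
  where "is_point X \<longleftrightarrow> (\<exists>a b. a \<noteq> b \<and> a \<sim> b \<and> X = pt a b)"

definition is_plane :: "'l set \<Rightarrow> bool"
  where "is_plane X \<longleftrightarrow> (\<exists>a b. a \<noteq> b \<and> a \<sim> b \<and> X = pl a b)"

lemma Sigma_linesD:
  assumes "c \<in> Sigma_lines a b"
  shows "a \<sim> c" "b \<sim> c"
  using assms inc_sym by (auto simp: Sigma_lines_def incident_to_all_def)

lemma spot_clique:
  assumes "spot X" "x \<in> X" "y \<in> X"
  shows "x \<sim> y"
  using assms axiom2_2 unfolding spot_def by blast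

text \<open>Axiom 2.2 makes a spot a clique. It is a maximal one because its three generators belong
  to it: a line incident to all of \<open>X\<close> is incident to them, hence lies in their
  bracket.\<close>

lemma mem_spot_iff:
  assumes "spot X"
  shows "x \<in> X \<longleftrightarrow> (\<forall>y\<in>X. x \<sim> y)"
proof
  assume "x \<in> X"
  then show "\<forall>y\<in>X. x \<sim> y" using spot_clique[OF assms] by blast
next
  assume all: "\<forall>y\<in>X. x \<sim> y"
  obtain a b c where abc: "a \<noteq> b" "a \<sim> b" "c \<in> Sigma_lines a b" "X = {a, b, c}\<^sup>\<sim>"
    using assms unfolding spot_def by blast
  then have "a \<in> X" "b \<in> X" "c \<in> X"
    using inc_refl inc_sym Sigma_linesD[OF abc(3)] by (auto simp: incident_to_all_def)
  then show "x \<in> X" using all inc_sym abc(4) by (auto simp: incident_to_all_def)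
qed

lemma spot_subset_eq:
  assumes "spot X" "spot Y" "X \<subseteq> Y"
  shows "X = Y"
  using assms mem_spot_iff spot_clique by blast

lemma spot_bracket: "a \<noteq> b \<Longrightarrow> a \<sim> b \<Longrightarrow> c \<in> Sigma_lines a b \<Longrightarrow> spot ({a, b, c}\<^sup>\<sim>)"
  unfolding spot_def by blast

lemma spot_subset_perp:
  assumes "spot X" "S \<subseteq> X"
  shows "X \<subseteq> S\<^sup>\<sim>"
  unfolding incident_to_all_def using spot_clique[OF assms(1)] assms(2) by blast

text \<open>The clique \<open>X\<close> is contained in the bracket of any of its lines, and one
  spot cannot properly contain another.\<close>

lemma spot_eq_bracket:
  assumes "spot X" "a \<in> X" "b \<in> X" "c \<in> X" "a \<noteq> b" "c \<in> Sigma_lines a b"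
  shows "X = {a, b, c}\<^sup>\<sim>"
proof (rule spot_subset_eq[OF assms(1)])
  show "spot ({a, b, c}\<^sup>\<sim>)"
    using spot_bracket[OF assms(5) spot_clique[OF assms(1-3)] assms(6)] .
  show "X \<subseteq> {a, b, c}\<^sup>\<sim>"
    by (rule spot_subset_perp[OF assms(1)]) (use assms in simp)
qed

text \<open>Otherwise every line of \<open>{a, b}\<^sup>\<sim>\<close> would be incident to all of
  \<open>X\<close> and so belong to \<open>X\<close> by maximality. Then
  \<open>{a, b}\<^sup>\<sim>\<close> would be a clique, against axiom 2.1.\<close>

lemma spot_contains_Sigma:
  assumes "spot X" "a \<in> X" "b \<in> X" "a \<noteq> b"
  obtains c where "c \<in> X" "c \<in> Sigma_lines a b"
proof -
  have ab: "a \<sim> b" using spot_clique[OF assms(1-3)] .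
  have sub: "X \<subseteq> {a, b}\<^sup>\<sim>" by (rule spot_subset_perp[OF assms(1)]) (use assms in simp)
  have "\<exists>c\<in>X. c \<in> Sigma_lines a b"
  proof (rule ccontr)
    assume "\<not> ?thesis"
    then have "X \<subseteq> ({a, b}\<^sup>\<sim>)\<^sup>\<sim>" using sub by (auto simp: Sigma_lines_def)
    then have "x \<in> X" if "x \<in> {a, b}\<^sup>\<sim>" for x
      using that mem_spot_iff[OF assms(1), of x] inc_sym unfolding incident_to_all_def by blast
    then show False using axiom2_1[OF assms(4) ab] spot_clique[OF assms(1)] by blast
  qed
  then show ?thesis using that by blast
qed

section \<open>The two labelled classes and the spots \<open>pt\<close> and
  \<open>pl\<close>\<close>

text \<open>The class of \<open>d\<close> is the trace on \<open>Sigma_lines a b\<close> of the spot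
  generated by \<open>a\<close>, \<open>b\<close>, \<open>d\<close>, and any other member of the
  class generates the same spot. This is the independence of representatives behind
  \<open>pt\<close> and \<open>pl\<close>.\<close>

lemma Sigma_class:
  assumes ab: "a \<noteq> b" "a \<sim> b"
    and T: "T \<in> Sigma_lines a b // inc_on (Sigma_lines a b)"
  shows "T \<noteq> {}" "T \<subseteq> Sigma_lines a b"
    "c \<in> T \<Longrightarrow> T = Sigma_lines a b \<inter> {a, b, c}\<^sup>\<sim>"
proof -
  obtain d where d: "d \<in> Sigma_lines a b" and Td: "T = {y \<in> Sigma_lines a b. d \<sim> y}"
    using T by (auto simp: quotient_def inc_on_def)
  show "T \<noteq> {}" "T \<subseteq> Sigma_lines a b" using d Td inc_refl by auto
  have spd: "spot ({a, b, d}\<^sup>\<sim>)" using spot_bracket[OF ab d] .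
  assume "c \<in> T"
  then have c: "c \<in> Sigma_lines a b" "d \<sim> c" using Td by auto
  have mem: "a \<in> {a, b, d}\<^sup>\<sim>" "b \<in> {a, b, d}\<^sup>\<sim>" "c \<in> {a, b, d}\<^sup>\<sim>"
    using ab c inc_refl inc_sym Sigma_linesD[OF d] Sigma_linesD[OF c(1)]
    by (auto simp: incident_to_all_def)
  have "{a, b, d}\<^sup>\<sim> = {a, b, c}\<^sup>\<sim>"
    using spot_eq_bracket[OF spd mem ab(1) c(1)] .
  moreover have "T = Sigma_lines a b \<inter> {a, b, d}\<^sup>\<sim>"
    unfolding Td using Sigma_linesD inc_sym by (auto simp: incident_to_all_def)
  ultimately show "T = Sigma_lines a b \<inter> {a, b, c}\<^sup>\<sim>" by simp
qed

lemma Sigma_pt_class: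
  assumes "a \<noteq> b" "a \<sim> b"
  shows "Sigma_pt a b \<in> Sigma_lines a b // inc_on (Sigma_lines a b)"
  using labelling[OF assms] by simp

lemma Sigma_pl_class:
  assumes "a \<noteq> b" "a \<sim> b"
  shows "Sigma_pl a b \<in> Sigma_lines a b // inc_on (Sigma_lines a b)"
  using labelling[OF assms] by simp

lemma bracket_SOME_class:
  assumes ab: "a \<noteq> b" "a \<sim> b"
    and T: "T \<in> Sigma_lines a b // inc_on (Sigma_lines a b)"
  shows "spot ({a, b, SOME c. c \<in> T}\<^sup>\<sim>)" "T = Sigma_lines a b \<inter> {a, b, SOME c. c \<in> T}\<^sup>\<sim>"
proof -
  have c: "(SOME c. c \<in> T) \<in> T" using Sigma_class(1)[OF assms] by (simp add: some_in_eq)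
  show "spot ({a, b, SOME c. c \<in> T}\<^sup>\<sim>)"
    using spot_bracket[OF ab] Sigma_class(2)[OF assms] c by (meson subsetD)
  show "T = Sigma_lines a b \<inter> {a, b, SOME c. c \<in> T}\<^sup>\<sim>"
    by (rule Sigma_class(3)[OF assms c])
qed

lemma
  assumes "a \<noteq> b" "a \<sim> b"
  shows spot_pt: "spot (pt a b)" and spot_pl: "spot (pl a b)"
    and Sigma_pt_eq: "Sigma_pt a b = Sigma_lines a b \<inter> pt a b"
    and Sigma_pl_eq: "Sigma_pl a b = Sigma_lines a b \<inter> pl a b"
  unfolding pt_def pl_def
  by (rule bracket_SOME_class[OF assms] Sigma_pt_class[OF assms] Sigma_pl_class[OF assms])+

lemma Sigma_lines_pt_or_pl:
  assumes "a \<noteq> b" "a \<sim> b" "c \<in> Sigma_lines a b"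
  shows "c \<in> pt a b \<or> c \<in> pl a b"
proof -
  have "inc_on (Sigma_lines a b) `` {c} \<in> {Sigma_pt a b, Sigma_pl a b}"
    using labelling[OF assms(1,2)] assms(3) by (metis quotientI)
  moreover have "c \<in> inc_on (Sigma_lines a b) `` {c}"
    using assms(3) inc_refl by (auto simp: inc_on_def)
  ultimately show ?thesis using Sigma_pt_eq Sigma_pl_eq assms by blast
qed

lemma pt_neq_pl: "a \<noteq> b \<Longrightarrow> a \<sim> b \<Longrightarrow> pt a b \<noteq> pl a b"
  using labelling Sigma_pt_eq Sigma_pl_eq by metis

lemma
  assumes "a \<noteq> b" "a \<sim> b"
  shows mem_pt: "a \<in> pt a b" "b \<in> pt a b" and mem_pl: "a \<in> pl a b" "b \<in> pl a b"
proof -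
  have *: "a \<in> {a, b, SOME c. c \<in> T}\<^sup>\<sim> \<and> b \<in> {a, b, SOME c. c \<in> T}\<^sup>\<sim>"
    if T: "T \<in> Sigma_lines a b // inc_on (Sigma_lines a b)" for T
  proof -
    have "(SOME c. c \<in> T) \<in> Sigma_lines a b"
      using Sigma_class(1,2)[OF assms T] some_in_eq[of T] by (meson subsetD)
    then show ?thesis
      using assms inc_refl inc_sym Sigma_linesD by (simp add: incident_to_all_def)
  qed
  show "a \<in> pt a b" "b \<in> pt a b" "a \<in> pl a b" "b \<in> pl a b"
    unfolding pt_def pl_def
    using *[OF Sigma_pt_class[OF assms]] *[OF Sigma_pl_class[OF assms]] by simp_all
qed

text \<open>Besides \<open>a\<close> and \<open>b\<close>, the spot contains a line of
  \<open>Sigma_lines a b\<close>. This line lies in \<open>pt a b\<close> or \<open>pl a b\<close>,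
  and it determines the spot together with \<open>a\<close> and \<open>b\<close>.\<close>

lemma spot_pt_or_pl:
  assumes "spot X" "a \<in> X" "b \<in> X" "a \<noteq> b"
  shows "X = pt a b \<or> X = pl a b"
proof -
  have ab: "a \<sim> b" using spot_clique[OF assms(1-3)] .
  obtain c where c: "c \<in> X" "c \<in> Sigma_lines a b" using spot_contains_Sigma[OF assms] .
  have "Y = X" if "spot Y" "a \<in> Y" "b \<in> Y" "c \<in> Y" for Y
    using that c spot_eq_bracket assms by metis
  then show ?thesis
    using Sigma_lines_pt_or_pl[OF assms(4) ab c(2)] spot_pt spot_pl mem_pt mem_pl assms(4) ab
    by metis
qed

section \<open>Points versus planes\<close>

lemma disjoint_spot:
  assumes "spot X"
  obtains Y where "spot Y" "X \<inter> Y = {}" "is_point Y \<or> is_plane Y"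
proof -
  obtain Y where Y: "spot Y" "X \<inter> Y = {}"
    using assms axiom3 unfolding spot_def by metis
  then obtain a b where "a \<noteq> b" "a \<in> Y" "b \<in> Y"
    unfolding spot_def incident_to_all_def using inc_refl inc_sym Sigma_linesD
    by (smt (verit) insert_iff empty_iff mem_Collect_eq)
  then have "is_point Y \<or> is_plane Y"
    using spot_pt_or_pl[OF Y(1)] spot_clique[OF Y(1)] unfolding is_point_def is_plane_def by metis
  then show ?thesis using that Y by blast
qed

lemma spot_point: "is_point X \<Longrightarrow> spot X"
  and spot_plane: "is_plane X \<Longrightarrow> spot X"
  unfolding is_point_def is_plane_def using spot_pt spot_pl by auto

lemma points_meet: "is_point X \<Longrightarrow> is_point Y \<Longrightarrow> X \<inter> Y \<noteq> {}"
  and planes_meet: "is_plane X \<Longrightarrow> is_plane Y \<Longrightarrow> X \<inter> Y \<noteq> {}"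
  unfolding is_point_def is_plane_def using axiom4_pt axiom4_pl by blast+

text \<open>A spot that is both a point and a plane would by axiom 4 meet every spot, contrary to
  axiom 3.\<close>

lemma not_point_and_plane: "\<not> (is_point X \<and> is_plane X)"
  using disjoint_spot spot_point points_meet planes_meet by metis

text \<open>The disjoint spot supplied by axiom 3 cannot be a point, since points meet.\<close>

lemma plane_disjoint_from_point:
  assumes "is_point X"
  obtains Y where "is_plane Y" "X \<inter> Y = {}"
  using assms disjoint_spot spot_point points_meet by metis

lemma is_point_pt: "a \<noteq> b \<Longrightarrow> a \<sim> b \<Longrightarrow> is_point (pt a b)"
  and is_plane_pl: "a \<noteq> b \<Longrightarrow> a \<sim> b \<Longrightarrow> is_plane (pl a b)"
  unfolding is_point_def is_plane_def by blast+

text \<open>Of the two spots through \<open>a\<close> and \<open>b\<close>, the one of the wrong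
  kind is excluded by \<open>not_point_and_plane\<close>. Hence two points, or two planes, with two
  common lines coincide.\<close>

lemma point_eq_pt: "is_point X \<Longrightarrow> a \<in> X \<Longrightarrow> b \<in> X \<Longrightarrow> a \<noteq> b \<Longrightarrow> X = pt a b"
  and plane_eq_pl: "is_plane X \<Longrightarrow> a \<in> X \<Longrightarrow> b \<in> X \<Longrightarrow> a \<noteq> b \<Longrightarrow> X = pl a b"
  using spot_pt_or_pl spot_point spot_plane is_point_pt is_plane_pl not_point_and_plane spot_clique
  by metis+

section \<open>Triads in terms of points and planes\<close>

text \<open>By maximality of \<open>Y\<close>, the line \<open>c\<close> is skew to some line of
  \<open>Y\<close>, and that line lies in \<open>{a, b}\<^sup>\<sim>\<close>.\<close>

lemma Sigma_lines_of_spots: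
  assumes "spot X" "spot Y" "a \<in> X" "b \<in> X" "a \<in> Y" "b \<in> Y" "c \<in> X" "c \<notin> Y"
  shows "c \<in> Sigma_lines a b"
proof -
  have "Y \<subseteq> {a, b}\<^sup>\<sim>" by (rule spot_subset_perp[OF assms(2)]) (use assms in simp)
  then have "c \<notin> ({a, b}\<^sup>\<sim>)\<^sup>\<sim>"
    using assms(8) mem_spot_iff[OF assms(2), of c] unfolding incident_to_all_def by blast
  moreover have "X \<subseteq> {a, b}\<^sup>\<sim>" by (rule spot_subset_perp[OF assms(1)]) (use assms in simp)
  ultimately show ?thesis
    using assms(7) by (auto simp: Sigma_lines_def)
qed

text \<open>The spot \<open>Y\<close> certifies that \<open>a\<close>, \<open>b\<close>,
  \<open>c\<close> generate \<open>X\<close>, so three incidences suffice for membership.\<close>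

lemma spot_absorbs:
  assumes "spot X" "spot Y" "a \<in> X" "b \<in> X" "a \<in> Y" "b \<in> Y" "a \<noteq> b"
    and c: "c \<in> X" "c \<notin> Y" and l: "l \<sim> a" "l \<sim> b" "l \<sim> c"
  shows "l \<in> X"
proof -
  have "X = {a, b, c}\<^sup>\<sim>"
    using spot_eq_bracket[of X a b c] Sigma_lines_of_spots[of X Y a b c] assms by blast
  then show ?thesis using l inc_sym by (auto simp: incident_to_all_def)
qed

text \<open>A line of \<open>Sigma_lines a b\<close> in both spots would generate each of them with
  \<open>a\<close> and \<open>b\<close>, but \<open>pt a b\<close> and \<open>pl a b\<close>
  differ.\<close>

lemma mem_Sigma_iff:
  assumes ab: "a \<noteq> b" "a \<sim> b"
  shows mem_Sigma_pt_iff: "c \<in> Sigma_pt a b \<longleftrightarrow> c \<in> pt a b \<and> c \<notin> pl a b"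
    and mem_Sigma_pl_iff: "c \<in> Sigma_pl a b \<longleftrightarrow> c \<in> pl a b \<and> c \<notin> pt a b"
    and mem_Sigma_lines_iff: "c \<in> Sigma_lines a b \<longleftrightarrow> (c \<in> pt a b) \<noteq> (c \<in> pl a b)"
proof -
  note pts = spot_pt[OF ab] spot_pl[OF ab] mem_pt[OF ab] mem_pl[OF ab]
  have "\<not> (c \<in> pt a b \<and> c \<in> pl a b)" if "c \<in> Sigma_lines a b"
    using spot_eq_bracket[of _ a b c] pts that ab pt_neq_pl[OF ab] by metis
  then show S: "c \<in> Sigma_lines a b \<longleftrightarrow> (c \<in> pt a b) \<noteq> (c \<in> pl a b)"
    using Sigma_lines_of_spots pts Sigma_lines_pt_or_pl[OF ab] by metis
  show "c \<in> Sigma_pt a b \<longleftrightarrow> c \<in> pt a b \<and> c \<notin> pl a b"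
    "c \<in> Sigma_pl a b \<longleftrightarrow> c \<in> pl a b \<and> c \<notin> pt a b"
    using S Sigma_pt_eq[OF ab] Sigma_pl_eq[OF ab] by auto
qed

text \<open>This trades the labels for points and planes and makes the symmetry in the three lines
  visible. For the converse, the common point is \<open>pt x y\<close> for any two of the lines,
  while \<open>pl x y\<close> has to miss the third.\<close>

lemma point_triad_iff:
  "point_triad a b c \<longleftrightarrow> distinct [a, b, c] \<and> (\<exists>P. is_point P \<and> {a, b, c} \<subseteq> P) \<and>
    \<not> (\<exists>\<rho>. is_plane \<rho> \<and> {a, b, c} \<subseteq> \<rho>)" (is "?L \<longleftrightarrow> ?R")
proof
  assume ?L
  then have abc: "distinct [a, b, c]" "a \<noteq> b" "a \<sim> b" "c \<in> Sigma_pt a b"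
    by (auto simp: point_triad_def triad_def)
  then have "c \<in> pt a b" "c \<notin> pl a b" using mem_Sigma_pt_iff by auto
  then show ?R
    using abc is_point_pt[OF abc(2,3)] mem_pt[OF abc(2,3)] plane_eq_pl[of _ a b] by auto
next
  assume R: ?R
  then obtain P where P: "is_point P" "a \<in> P" "b \<in> P" "c \<in> P" by auto
  have inc: "x \<sim> y" if "x \<in> P" "y \<in> P" for x y
    using that spot_clique spot_point P(1) by blast
  have *: "z \<in> Sigma_pt x y \<and> z \<in> Sigma_lines x y"
    if "x \<in> P" "y \<in> P" "z \<in> P" "x \<noteq> y" "{x, y, z} = {a, b, c}" for x y z
  proof -
    have "P = pt x y" using point_eq_pt P(1) that by blast
    moreover have "z \<notin> pl x y"
      using R that is_plane_pl[of x y] mem_pl[of x y] inc[of x y] by (metis empty_subsetI insert_subset)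
    ultimately show ?thesis using that inc[of x y] by (simp add: mem_Sigma_iff)
  qed
  show ?L
    using R P inc *[of a b c] *[of b c a] *[of c a b]
    unfolding point_triad_def triad_def by (auto simp: insert_commute)
qed

lemma plane_triad_iff:
  "plane_triad a b c \<longleftrightarrow> distinct [a, b, c] \<and> (\<exists>\<rho>. is_plane \<rho> \<and> {a, b, c} \<subseteq> \<rho>) \<and>
    \<not> (\<exists>P. is_point P \<and> {a, b, c} \<subseteq> P)" (is "?L \<longleftrightarrow> ?R")
proof
  assume ?L
  then have abc: "distinct [a, b, c]" "a \<noteq> b" "a \<sim> b" "c \<in> Sigma_pl a b"
    by (auto simp: plane_triad_def triad_def)
  then have "c \<in> pl a b" "c \<notin> pt a b" using mem_Sigma_pl_iff by auto
  then show ?R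
    using abc is_plane_pl[OF abc(2,3)] mem_pl[OF abc(2,3)] point_eq_pt[of _ a b] by auto
next
  assume R: ?R
  then obtain \<rho> where \<rho>: "is_plane \<rho>" "a \<in> \<rho>" "b \<in> \<rho>" "c \<in> \<rho>" by auto
  have inc: "x \<sim> y" if "x \<in> \<rho>" "y \<in> \<rho>" for x y
    using that spot_clique spot_plane \<rho>(1) by blast
  have *: "z \<in> Sigma_pl x y \<and> z \<in> Sigma_lines x y"
    if "x \<in> \<rho>" "y \<in> \<rho>" "z \<in> \<rho>" "x \<noteq> y" "{x, y, z} = {a, b, c}" for x y z
  proof -
    have "\<rho> = pl x y" using plane_eq_pl \<rho>(1) that by blast
    moreover have "z \<notin> pt x y"
      using R that is_point_pt[of x y] mem_pt[of x y] inc[of x y] by (metis empty_subsetI insert_subset)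
    ultimately show ?thesis using that inc[of x y] by (simp add: mem_Sigma_iff)
  qed
  show ?L
    using R \<rho> inc *[of a b c] *[of b c a] *[of c a b]
    unfolding plane_triad_def triad_def by (auto simp: insert_commute)
qed

lemma the_elem_points:
  assumes "is_point X" "is_point Y" "X \<noteq> Y" "a \<in> X" "a \<in> Y"
  shows "the_elem (X \<inter> Y) = a"
proof -
  have "X \<inter> Y = {a}" using assms point_eq_pt by blast
  then show ?thesis by simp
qed

lemma the_elem_planes:
  assumes "is_plane X" "is_plane Y" "X \<noteq> Y" "a \<in> X" "a \<in> Y"
  shows "the_elem (X \<inter> Y) = a"
proof -
  have "X \<inter> Y = {a}" using assms plane_eq_pl by blast
  then show ?thesis by simp
qed

section \<open>Cutting planes through a point by a disjoint plane\<close>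

text \<open>A point on a plane shares a whole pencil of lines with it; two common lines suffice.\<close>

definition on_plane :: "'l set \<Rightarrow> 'l set \<Rightarrow> bool"
  where "on_plane P \<rho> \<longleftrightarrow> is_point P \<and> is_plane \<rho> \<and> (\<exists>u v. u \<noteq> v \<and> {u, v} \<subseteq> P \<inter> \<rho>)"

lemma on_plane_pl:
  assumes "is_point P" "u \<in> P" "v \<in> P" "u \<noteq> v"
  shows "on_plane P (pl u v)"
  using assms is_plane_pl mem_pl spot_clique[OF spot_point[OF assms(1)]] unfolding on_plane_def by blast

text \<open>The line \<open>m\<close> joining \<open>P\<close> and \<open>Q\<close> is incident to
  two pencil lines within \<open>P\<close> and to \<open>l\<close> within \<open>Q\<close>, and
  these three lines generate \<open>\<rho>\<close>.\<close>

lemma common_line_in_plane: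
  assumes "on_plane P \<rho>" "l \<in> \<rho>" "l \<notin> P" "is_point Q" "l \<in> Q" "m \<in> P" "m \<in> Q"
  shows "m \<in> \<rho>"
proof -
  obtain u v where "u \<noteq> v" "u \<in> P" "u \<in> \<rho>" "v \<in> P" "v \<in> \<rho>" "is_point P" "is_plane \<rho>"
    using assms(1) unfolding on_plane_def by auto
  then show ?thesis
    using assms spot_absorbs[of \<rho> P u v l m] spot_point spot_plane spot_clique by blast
qed

text \<open>The line joining \<open>P\<close> to the common point \<open>Q\<close> of the three
  sections lies in each of the three planes. Read backwards, planes without a common line have
  non-concurrent sections.\<close>

lemma section_concurrent:
  assumes "on_plane P \<rho>1" "on_plane P \<rho>2" "on_plane P \<rho>3" "P \<inter> \<pi> = {}"
    and "x \<in> \<rho>1 \<inter> \<pi>" "y \<in> \<rho>2 \<inter> \<pi>" "z \<in> \<rho>3 \<inter> \<pi>"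
    and "is_point Q" "{x, y, z} \<subseteq> Q"
  obtains m where "m \<in> \<rho>1" "m \<in> \<rho>2" "m \<in> \<rho>3"
proof -
  obtain m where m: "m \<in> P" "m \<in> Q"
    using assms(1,8) points_meet unfolding on_plane_def by blast
  have "m \<in> \<rho>1" "m \<in> \<rho>2" "m \<in> \<rho>3"
    using common_line_in_plane[OF assms(1), of x Q m] common_line_in_plane[OF assms(2), of y Q m]
      common_line_in_plane[OF assms(3), of z Q m] assms m by auto
  then show ?thesis using that by blast
qed

text \<open>Here \<open>pt x y\<close> is the point in which \<open>m\<close>, the common line of
  the two planes, meets \<open>\<pi>\<close>. Every plane through \<open>m\<close> therefore cuts
  \<open>\<pi>\<close> in a line through it.\<close>

lemma section_point:
  assumes \<rho>: "on_plane P \<rho>1" "on_plane P \<rho>2" "\<rho>1 \<noteq> \<rho>2" and \<pi>: "is_plane \<pi>" "P \<inter> \<pi> = {}"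
    and x: "x \<in> \<rho>1 \<inter> \<pi>" and y: "y \<in> \<rho>2 \<inter> \<pi>" and m: "m \<in> P" "m \<in> \<rho>1" "m \<in> \<rho>2"
  shows "x \<noteq> y" "is_point (pt x y)" "x \<in> pt x y" "y \<in> pt x y"
    "\<And>\<tau> z. is_plane \<tau> \<Longrightarrow> m \<in> \<tau> \<Longrightarrow> z \<in> \<tau> \<Longrightarrow> z \<in> \<pi> \<Longrightarrow> z \<in> pt x y"
proof -
  have pl: "is_point P" "is_plane \<rho>1" "is_plane \<rho>2" using \<rho> by (auto simp: on_plane_def)
  have only: "m' = m" if "m' \<in> \<rho>1" "m' \<in> \<rho>2" for m'
    using that plane_eq_pl pl m \<rho>(3) by metis
  show xy: "x \<noteq> y" using only x y m \<pi>(2) by blast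
  have inc: "x \<sim> y" using x y \<pi>(1) spot_clique spot_plane by blast
  show Q: "is_point (pt x y)" "x \<in> pt x y" "y \<in> pt x y"
    using is_point_pt mem_pt xy inc by auto
  \<comment> \<open>The join of \<open>P\<close> and \<open>pt x y\<close> lies in both planes,
    which leaves only \<open>m\<close>.\<close>
  obtain m' where m': "m' \<in> P" "m' \<in> pt x y" using points_meet[OF pl(1) Q(1)] by blast
  have "m' = m"
    using only common_line_in_plane[OF \<rho>(1) _ _ Q(1,2) m'] common_line_in_plane[OF \<rho>(2) _ _ Q(1,3) m']
      x y \<pi>(2) by blast
  then have mQ: "m \<in> pt x y" "m \<notin> \<pi>" using m m' \<pi>(2) by auto
  fix \<tau> z assume "is_plane \<tau>" "m \<in> \<tau>" "z \<in> \<tau>" "z \<in> \<pi>"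
  \<comment> \<open>The first two incidences hold inside \<open>\<pi>\<close>, the third inside
    \<open>\<tau>\<close>. As \<open>m\<close> is not in \<open>\<pi>\<close>, the lines
    \<open>x\<close>, \<open>y\<close>, \<open>m\<close> generate \<open>pt x y\<close>.\<close>
  then have "z \<sim> x" "z \<sim> y" "z \<sim> m" using x y \<pi>(1) spot_clique spot_plane by blast+
  then show "z \<in> pt x y"
    using spot_absorbs[of "pt x y" \<pi> x y m z] spot_point[OF Q(1)] spot_plane[OF \<pi>(1)] Q x y xy mQ
    by blast
qed

text \<open>The line \<open>a\<close> is incident to \<open>s\<close> and \<open>p\<close> inside
  one plane and to \<open>q\<close> inside the other. Since \<open>q\<close> is off the plane
  \<open>pl s p\<close>, these three lines generate \<open>P\<close>.\<close>

lemma diagonal_in_point: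
  assumes "is_point P" "p \<in> P" "q \<in> P" "r \<in> P" "s \<in> P" "s \<noteq> p" "q \<noteq> r" "q \<notin> pl s p"
    and "a \<in> pl s p \<inter> pl q r"
  shows "a \<in> P"
proof -
  have inc: "x \<sim> y" if "x \<in> P" "y \<in> P" for x y
    using that spot_clique spot_point assms(1) by blast
  have "a \<sim> s" "a \<sim> p" "a \<sim> q"
    using assms inc mem_pl spot_pl spot_clique by (meson IntD1 IntD2)+
  then show ?thesis
    using spot_absorbs[of P "pl s p" s p q a] assms inc mem_pl spot_pl spot_point by blast
qed

section \<open>The section tetrad and its diagonals\<close>

theorem H_pl_imp_H_pt:
  assumes H_pl
  shows H_pt
  unfolding H_pt_def
proof (intro allI impI)
  fix s p q r
  assume tet: "point_tetrad s p q r"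
  then have T: "point_triad p q r" "point_triad s q r" "point_triad s r p" "point_triad s p q"
    by (auto simp: point_tetrad_def)
  have ne: "s \<noteq> p" "s \<noteq> q" "s \<noteq> r" "p \<noteq> q" "q \<noteq> r" "r \<noteq> p"
    using T by (auto simp: point_triad_iff)
  have N: "\<not> {p, q, r} \<subseteq> \<rho>" "\<not> {s, q, r} \<subseteq> \<rho>" "\<not> {s, r, p} \<subseteq> \<rho>" "\<not> {s, p, q} \<subseteq> \<rho>"
    if "is_plane \<rho>" for \<rho>
    using T[unfolded point_triad_iff] that by metis+
  obtain P where P: "is_point P" "p \<in> P" "q \<in> P" "r \<in> P" "s \<in> P"
  proof -
    obtain P P' where PP: "is_point P" "{p, q, r} \<subseteq> P" "is_point P'" "{s, q, r} \<subseteq> P'"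
      using T(1,2)[unfolded point_triad_iff] by metis
    have "P = pt q r" "P' = pt q r"
      using point_eq_pt[OF PP(1), of q r] point_eq_pt[OF PP(3), of q r] PP(2,4) ne(5) by simp_all
    then show ?thesis using that PP by simp
  qed
  have inc: "x \<sim> y" if "x \<in> P" "y \<in> P" for x y
    using that spot_clique spot_point P(1) by blast
  obtain \<pi> where \<pi>: "is_plane \<pi>" "P \<inter> \<pi> = {}" using plane_disjoint_from_point[OF P(1)] .
  \<comment> \<open>Consecutive planes are opposite: the pairs \<open>A1\<close>/\<open>A2\<close>,
    \<open>A3\<close>/\<open>A4\<close> and \<open>A5\<close>/\<open>A6\<close> cut out the three
    diagonals.\<close>
  define A1 A2 A3 A4 A5 A6
    where "A1 = pl s p" and "A2 = pl q r" and "A3 = pl s q" and "A4 = pl r p"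
      and "A5 = pl s r" and "A6 = pl p q"
  note A_defs = A1_def A2_def A3_def A4_def A5_def A6_def
  have on: "on_plane P A1" "on_plane P A2" "on_plane P A3" "on_plane P A4" "on_plane P A5"
    "on_plane P A6"
    using on_plane_pl P ne by (auto simp: A_defs)
  then have pl: "is_plane A1" "is_plane A2" "is_plane A3" "is_plane A4" "is_plane A5" "is_plane A6"
    by (auto simp: on_plane_def)
  have mem: "s \<in> A1" "p \<in> A1" "q \<in> A2" "r \<in> A2" "s \<in> A3" "q \<in> A3" "r \<in> A4" "p \<in> A4"
    "s \<in> A5" "r \<in> A5" "p \<in> A6" "q \<in> A6"
    using mem_pl ne inc P by (auto simp: A_defs)
  note N' = N[OF pl(1)] N[OF pl(2)] N[OF pl(3)] N[OF pl(4)] N[OF pl(5)] N[OF pl(6)]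
  have Ane: "A1 \<noteq> A2" "A1 \<noteq> A3" "A1 \<noteq> A4" "A2 \<noteq> A3" "A2 \<noteq> A4" "A3 \<noteq> A4" "A5 \<noteq> A6"
    using N' mem by auto
  obtain a b c where abc: "a \<in> A1" "a \<in> A2" "b \<in> A3" "b \<in> A4" "c \<in> A5" "c \<in> A6"
    using planes_meet[OF pl(1,2)] planes_meet[OF pl(3,4)] planes_meet[OF pl(5,6)]
    by (meson disjoint_iff)
  have P_abc: "a \<in> P" "b \<in> P" "c \<in> P"
    using diagonal_in_point[OF P(1), of p q r s a, folded A_defs]
      diagonal_in_point[OF P(1), of q r p s b, folded A_defs]
      diagonal_in_point[OF P(1), of r p q s c, folded A_defs] P ne abc N' mem
    by auto
  have meet: "x = y" if "is_plane \<rho>" "is_plane \<rho>'" "\<rho> \<noteq> \<rho>'" "x \<in> \<rho>" "x \<in> \<rho>'" "y \<in> \<rho>" "y \<in> \<rho>'"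
    for x y \<rho> \<rho>'
    using that plane_eq_pl by metis
  \<comment> \<open>Each triple contains two pairs of non-opposite planes, and these pairs meet in
    two different lines of the tetrad.\<close>
  have no_common: "\<not> (m \<in> A1 \<and> m \<in> A2 \<and> m \<in> A3)" "\<not> (m \<in> A1 \<and> m \<in> A2 \<and> m \<in> A4)"
    "\<not> (m \<in> A1 \<and> m \<in> A3 \<and> m \<in> A4)" "\<not> (m \<in> A2 \<and> m \<in> A3 \<and> m \<in> A4)" for m
    using meet[OF pl(1,3) Ane(2), of m s] meet[OF pl(2,3) Ane(4), of m q]
      meet[OF pl(1,4) Ane(3), of m p] meet[OF pl(2,4) Ane(5), of m r] mem ne by auto
  have Ane': "A1 \<noteq> A5" "A2 \<noteq> A6" "A3 \<noteq> A5" "A4 \<noteq> A6" using N' mem by auto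
  have "a \<noteq> b" using no_common(1)[of a] abc by auto
  moreover have "b \<noteq> c"
    using meet[OF pl(3,5) Ane'(3), of b s] meet[OF pl(4,6) Ane'(4), of b p] abc mem ne by auto
  moreover have "c \<noteq> a"
    using meet[OF pl(1,5) Ane'(1), of a s] meet[OF pl(2,6) Ane'(2), of a q] abc mem ne by auto
  ultimately have abc_distinct: "distinct [a, b, c]" by auto
  have "\<not> {a, b, c} \<subseteq> \<sigma>" if \<sigma>: "is_plane \<sigma>" for \<sigma>
  proof
    assume "{a, b, c} \<subseteq> \<sigma>"
    then have \<sigma>_abc: "a \<in> \<sigma>" "b \<in> \<sigma>" "c \<in> \<sigma>" by auto
    have "\<exists>x. x \<in> \<rho> \<inter> \<pi>" if "is_plane \<rho>" for \<rho>
      using planes_meet[OF that \<pi>(1)] by blast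
    then obtain sec where sec: "sec \<rho> \<in> \<rho> \<inter> \<pi>" if "is_plane \<rho>" for \<rho>
      by metis
    \<comment> \<open>The sections \<open>l1\<close> to \<open>l4\<close> will form the tetrad;
      those of \<open>\<sigma>\<close>, \<open>A5\<close>, \<open>A6\<close> will be its
      diagonals.\<close>
    obtain l1 l2 l3 l4 d1 d2 d3 where l: "l1 \<in> A1 \<inter> \<pi>" "l2 \<in> A2 \<inter> \<pi>" "l3 \<in> A3 \<inter> \<pi>" "l4 \<in> A4 \<inter> \<pi>"
      and d: "d1 \<in> \<sigma> \<inter> \<pi>" "d2 \<in> A5 \<inter> \<pi>" "d3 \<in> A6 \<inter> \<pi>"
      by (rule that[OF pl(1-4)[THEN sec] \<sigma>[THEN sec] pl(5,6)[THEN sec]])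
    \<comment> \<open>The vertices of the section tetrad are the traces on \<open>\<pi>\<close> of
      \<open>a\<close>, \<open>b\<close>, \<open>s\<close>, \<open>r\<close>, \<open>p\<close>,
      \<open>q\<close> in this order. The last fact concerns the trace of \<open>c\<close>, where
      \<open>d2\<close> and \<open>d3\<close> meet.\<close>
    note S12 = section_point[OF on(1,2) Ane(1) \<pi> l(1,2) P_abc(1) abc(1,2)]
      and S34 = section_point[OF on(3,4) Ane(6) \<pi> l(3,4) P_abc(2) abc(3,4)]
      and S13 = section_point[OF on(1,3) Ane(2) \<pi> l(1,3) P(5) mem(1,5)]
      and S42 = section_point[OF on(4,2) Ane(5)[symmetric] \<pi> l(4,2) P(4) mem(7,4)]
      and S14 = section_point[OF on(1,4) Ane(3) \<pi> l(1,4) P(2) mem(2,8)]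
      and S23 = section_point[OF on(2,3) Ane(4) \<pi> l(2,3) P(3) mem(3,6)]
      and S56 = section_point[OF on(5,6) Ane(7) \<pi> d(2,3) P_abc(3) abc(5,6)]
    have nc: "\<not> {l1, l2, l3} \<subseteq> Q" "\<not> {l1, l2, l4} \<subseteq> Q" "\<not> {l1, l3, l4} \<subseteq> Q" "\<not> {l2, l3, l4} \<subseteq> Q"
      if Q: "is_point Q" for Q
      using section_concurrent[OF on(1,2,3) \<pi>(2) l(1,2,3) Q]
        section_concurrent[OF on(1,2,4) \<pi>(2) l(1,2,4) Q]
        section_concurrent[OF on(1,3,4) \<pi>(2) l(1,3,4) Q]
        section_concurrent[OF on(2,3,4) \<pi>(2) l(2,3,4) Q] no_common by metis+
    have "plane_tetrad l1 l2 l3 l4"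
      unfolding plane_tetrad_def plane_triad_iff
      using nc S12(1) S34(1) S13(1) S42(1) S14(1) S23(1) \<pi>(1) l by (auto simp: insert_commute)
    then have triad: "plane_triad (the_elem (pt l1 l2 \<inter> pt l3 l4)) (the_elem (pt l1 l3 \<inter> pt l4 l2))
        (the_elem (pt l1 l4 \<inter> pt l2 l3))"
      using assms unfolding H_pl_def by blast
    \<comment> \<open>A diagonal joins two opposite vertices, so it is the section of a plane
      through the two corresponding lines: \<open>\<sigma>\<close> through \<open>a\<close> and
      \<open>b\<close>, \<open>A5\<close> through \<open>s\<close> and \<open>r\<close>,
      \<open>A6\<close> through \<open>p\<close> and \<open>q\<close>.\<close>
    have "the_elem (pt l1 l2 \<inter> pt l3 l4) = d1"
      using nc(1)[OF S12(2)] S12(2-4) S34(2-4) S12(5)[OF \<sigma> \<sigma>_abc(1)] S34(5)[OF \<sigma> \<sigma>_abc(2)] d(1)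
      by (intro the_elem_points) auto
    moreover have "the_elem (pt l1 l3 \<inter> pt l4 l2) = d2"
      using nc(1)[OF S13(2)] S13(2-4) S42(2-4) S13(5)[OF pl(5) mem(9)] S42(5)[OF pl(5) mem(10)] d(2)
      by (intro the_elem_points) auto
    moreover have "the_elem (pt l1 l4 \<inter> pt l2 l3) = d3"
      using nc(2)[OF S14(2)] S14(2-4) S23(2-4) S14(5)[OF pl(6) mem(11)] S23(5)[OF pl(6) mem(12)] d(3)
      by (intro the_elem_points) auto
    \<comment> \<open>Only here is \<open>c\<close> in \<open>\<sigma>\<close> used: it makes the
      three diagonals concurrent, which a plane-triad forbids.\<close>
    moreover have "d1 \<in> pt d2 d3" using S56(5)[OF \<sigma> \<sigma>_abc(3)] d(1) by auto
    ultimately show False using triad S56(2-4) unfolding plane_triad_iff by blast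
  qed
  then have "point_triad a b c"
    unfolding point_triad_iff using P(1) P_abc abc_distinct by auto
  moreover have "the_elem (pl s p \<inter> pl q r) = a" "the_elem (pl s q \<inter> pl r p) = b"
    "the_elem (pl s r \<inter> pl p q) = c"
    using the_elem_planes[OF pl(1,2) Ane(1) abc(1,2)] the_elem_planes[OF pl(3,4) Ane(6) abc(3,4)]
      the_elem_planes[OF pl(5,6) Ane(7) abc(5,6)]
    unfolding A_defs .
  ultimately show "point_triad (the_elem (pl s p \<inter> pl q r)) (the_elem (pl s q \<inter> pl r p))
      (the_elem (pl s r \<inter> pl p q))"
    by simp
qed

end

theorem theorem3:
  fixes inc :: "'l \<Rightarrow> 'l \<Rightarrow> bool"
    and Sigma_pt Sigma_pl :: "'l \<Rightarrow> 'l \<Rightarrow> 'l set"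
  assumes "linear_projective_space inc Sigma_pt Sigma_pl"
    and "labelled_line_incidence.H_pl inc Sigma_pt Sigma_pl"
  shows "labelled_line_incidence.H_pt inc Sigma_pt Sigma_pl"
  using assms linear_projective_space.H_pl_imp_H_pt by blast

end
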